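(* Let $\mu,\nu,\tilde\nu$ be probability measures on $\mathbb{R}^d$ with finite second moments. Let $\pi$ be an optimal transport plan between $\mu$ and $\nu$ and let $\tilde\pi$ be an optimal transport plan between $\mu$ and $\tilde\nu$, and suppose that $(\mu,\tilde\nu)\in M(\mu,\nu)$, i.e. the pair $(\mu,\tilde\nu)$ (with plan $\tilde\pi$) contains the McCann interpolation between $\mu$ and $\nu$ (with plan $\pi$). Let $t\in[0,1]$, let $\mu_t=(P_t)_\#\pi$, and let $s\in[0,1]$ be the associated time coordinate such that $(P_s)_\#\tilde\pi=(P_t)_\#\pi$. Then $$(1-t)\,W_2^2(\mu,\mu_t)+t\,W_2^2(\nu,\mu_t)\ \le\ (1-s)\,W_2^2(\mu,\mu_t)+s\,W_2^2(\tilde\nu,\mu_t).$$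
   Context: For probability measures $\mu,\nu$ on $\mathbb{R}^d$, $\Pi(\mu,\nu)$ is the set of probability measures on $\mathbb{R}^d\times\mathbb{R}^d$ with marginals $\mu$ and $\nu$, and $W_2^2(\mu,\nu)=\min_{\gamma\in\Pi(\mu,\nu)}\int\|\mathbf{x}-\mathbf{y}\|_2^2\,d\gamma(\mathbf{x},\mathbf{y})$; a minimizer is called an optimal transport plan. For $t\in[0,1]$, $P_t(\mathbf{x},\mathbf{y})=(1-t)\mathbf{x}+t\mathbf{y}$, and $(P_t)_\#$ denotes pushforward by $P_t$. If $\pi$ is an optimal transport plan between $\mu$ and $\nu$, the McCann interpolation between $\mu$ and $\nu$ is the family $\{(P_t)_\#\pi\}_{t\in[0,1]}$. Containment: let $\mu,\nu$ have optimal transport plan $\pi$ and let $\tilde\mu,\tilde\nu$ have optimal transport plan $\tilde\pi$. The pair $(\tilde\mu,\tilde\nu)$ is said to contain the McCann interpolation between $\mu$ and $\nu$ if there exists an interval $[a,b]\subset[0,1]$ such that for every $t\in[0,1]$ there exists $s\in[a,b]$ with $(P_s)_\#\tilde\pi=(P_t)_\#\pi$. The set of all pairs $(\tilde\mu,\tilde\nu)$ that contain the McCann interpolation between $\mu$ and $\nu$ is denoted $M(\mu,\nu)$. *)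

theory Defs
  imports "HOL-Probability.Probability"
begin

text \<open>The Euclidean space is kept abstract here; the norm on \<^typ>\<open>real ^ 'd\<close> is the 2-norm.\<close>

definition borel_prob :: "'a::euclidean_space measure \<Rightarrow> bool" where
  "borel_prob \<mu> \<longleftrightarrow> prob_space \<mu> \<and> sets \<mu> = sets borel"

definition finite_second_moment :: "'a::euclidean_space measure \<Rightarrow> bool" where
  "finite_second_moment \<mu> \<longleftrightarrow> integrable \<mu> (\<lambda>x. (norm x)\<^sup>2)"

definition couplings ::
  "'a::euclidean_space measure \<Rightarrow> 'a measure \<Rightarrow> ('a \<times> 'a) measure set" where
  "couplings \<mu> \<nu> =
     {\<gamma>. borel_prob \<gamma> \<and> distr \<gamma> borel fst = \<mu> \<and> distr \<gamma> borel snd = \<nu>}"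

definition transport_cost :: "('a::euclidean_space \<times> 'a) measure \<Rightarrow> ennreal" where
  "transport_cost \<gamma> = (\<integral>\<^sup>+ z. ennreal ((norm (fst z - snd z))\<^sup>2) \<partial>\<gamma>)"

text \<open>The squared distance is extended-valued, so that no junk value arises when every
  coupling has infinite cost. It is the minimal cost whenever an optimal plan exists.\<close>

definition W2_squared :: "'a::euclidean_space measure \<Rightarrow> 'a measure \<Rightarrow> ennreal" where
  "W2_squared \<mu> \<nu> = (INF \<gamma>\<in>couplings \<mu> \<nu>. transport_cost \<gamma>)"

definition optimal_plan ::
  "('a::euclidean_space \<times> 'a) measure \<Rightarrow> 'a measure \<Rightarrow> 'a measure \<Rightarrow> bool" where
  "optimal_plan \<pi> \<mu> \<nu> \<longleftrightarrow>
     \<pi> \<in> couplings \<mu> \<nu> \<and> (\<forall>\<gamma>\<in>couplings \<mu> \<nu>. transport_cost \<pi> \<le> transport_cost \<gamma>)"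

definition interp_map :: "real \<Rightarrow> 'a::euclidean_space \<times> 'a \<Rightarrow> 'a" where
  "interp_map t = (\<lambda>(x, y). (1 - t) *\<^sub>R x + t *\<^sub>R y)"

definition mccann :: "('a::euclidean_space \<times> 'a) measure \<Rightarrow> real \<Rightarrow> 'a measure" where
  "mccann \<pi> t = distr \<pi> borel (interp_map t)"

text \<open>Membership of the pair \<open>(\<mu>', \<nu>')\<close> in \<open>M(\<mu>, \<nu>)\<close>. Optimal plans need not be
  unique, so the plans \<open>\<pi>'\<close> and \<open>\<pi>\<close> to which it refers are explicit arguments.\<close>

definition contains_mccann ::
  "'a::euclidean_space measure \<Rightarrow> 'a measure \<Rightarrow> ('a \<times> 'a) measure \<Rightarrow>
   'a measure \<Rightarrow> 'a measure \<Rightarrow> ('a \<times> 'a) measure \<Rightarrow> bool" where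
  "contains_mccann \<mu>' \<nu>' \<pi>' \<mu> \<nu> \<pi> \<longleftrightarrow>
     optimal_plan \<pi>' \<mu>' \<nu>' \<and> optimal_plan \<pi> \<mu> \<nu> \<and>
     (\<exists>a b. a \<le> b \<and> {a..b} \<subseteq> {0..1} \<and>
        (\<forall>t\<in>{0..1}. \<exists>s\<in>{a..b}. mccann \<pi>' s = mccann \<pi> t))"

end

theory Submission
  imports Defs
begin

text \<open>Write \<open>D\<close> and \<open>D'\<close> for the squared distances from \<open>\<mu>\<close> to \<open>\<nu>\<close> and to \<open>\<nu>'\<close>. Gluing two plans
  along \<open>\<sigma>\<close> and using the convexity of the squared norm gives
  \<open>s (1 - s) W\<^sup>2(\<mu>, \<nu>) \<le> (1 - s) W\<^sup>2(\<mu>, \<sigma>) + s W\<^sup>2(\<nu>, \<sigma>)\<close>, so the right-hand side of the theorem is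
  at least \<open>s (1 - s) D'\<close>, while the obvious couplings bound the left-hand side by \<open>t (1 - t) D\<close>.
  The same inequality makes the interpolation a geodesic, hence \<open>t\<^sup>2 D = W\<^sup>2(\<mu>, \<mu>\<^sub>t) = s\<^sup>2 D'\<close>.
  Containment places \<open>\<nu>\<close> on the interpolation towards \<open>\<nu>'\<close>, so \<open>D \<le> D'\<close>; therefore
  \<open>t D \<le> s D'\<close>, and \<open>t (1 - t) D \<le> s (1 - s) D'\<close>.\<close>

section \<open>Measurability, couplings and transport cost\<close>

text \<open>Plans carry the Borel sets of the product space rather than a literal product
  sigma-algebra, so measurability of the projections is drawn from their continuity.\<close>

lemma borel_measurable_fst_snd [measurable (raw)]:
  fixes f :: "'b \<Rightarrow> 'a::euclidean_space \<times> 'c::euclidean_space"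
  assumes "f \<in> borel_measurable M"
  shows "(\<lambda>x. fst (f x)) \<in> borel_measurable M" and "(\<lambda>x. snd (f x)) \<in> borel_measurable M"
  by (rule borel_measurable_continuous_on[OF _ assms]; intro continuous_intros)+

lemma borel_measurable_fst_snd' [measurable]:
  "fst \<in> borel_measurable (borel :: ('a::euclidean_space \<times> 'c::euclidean_space) measure)"
  "snd \<in> borel_measurable (borel :: ('a::euclidean_space \<times> 'c::euclidean_space) measure)"
  using borel_measurable_fst_snd[of "\<lambda>x. x" borel] by simp_all

lemma borel_probD:
  assumes "borel_prob \<mu>"
  shows "prob_space \<mu>" and "sets \<mu> = sets borel" and "space \<mu> = UNIV"
  using assms sets_eq_imp_space_eq[of \<mu> borel] by (auto simp: borel_prob_def)

lemma couplingsD: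
  assumes "\<gamma> \<in> couplings \<mu> \<nu>"
  shows "borel_prob \<gamma>" and "distr \<gamma> borel fst = \<mu>" and "distr \<gamma> borel snd = \<nu>"
  using assms by (auto simp: couplings_def)

text \<open>Source of the explicit competitors for \<open>W2_squared\<close>. The measure
  \<open>\<gamma>\<close> may live on any topological space, so that it can be a plan or a measure
  on pairs of pairs.\<close>

lemma distr_mem_couplings:
  fixes \<gamma> :: "'b::topological_space measure"
    and f g :: "'b \<Rightarrow> 'a::euclidean_space"
  assumes "prob_space \<gamma>" and [measurable_cong]: "sets \<gamma> = sets borel"
    and [measurable]: "f \<in> borel_measurable borel" "g \<in> borel_measurable borel"
  shows "distr \<gamma> borel (\<lambda>z. (f z, g z)) \<in> couplings (distr \<gamma> borel f) (distr \<gamma> borel g)"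
proof -
  interpret prob_space \<gamma> by fact
  have [measurable]: "(\<lambda>z. (f z, g z)) \<in> borel_measurable \<gamma>" by measurable
  show ?thesis
    by (auto simp: couplings_def borel_prob_def distr_distr comp_def intro!: prob_space_distr)
qed

lemma transport_cost_distr:
  fixes \<gamma> :: "'b::topological_space measure"
    and f g :: "'b \<Rightarrow> 'a::euclidean_space"
  assumes [measurable_cong]: "sets \<gamma> = sets borel"
    and [measurable]: "f \<in> borel_measurable borel" "g \<in> borel_measurable borel"
  shows "transport_cost (distr \<gamma> borel (\<lambda>z. (f z, g z)))
    = (\<integral>\<^sup>+ z. ennreal ((norm (f z - g z))\<^sup>2) \<partial>\<gamma>)"
  unfolding transport_cost_def by (subst nn_integral_distr) auto

lemma W2_squared_le: "\<gamma> \<in> couplings \<mu> \<nu> \<Longrightarrow> W2_squared \<mu> \<nu> \<le> transport_cost \<gamma>"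
  unfolding W2_squared_def by (rule INF_lower)

lemma W2_squared_optimal_plan:
  assumes "optimal_plan \<pi> \<mu> \<nu>"
  shows "W2_squared \<mu> \<nu> = transport_cost \<pi>"
  using assms unfolding W2_squared_def optimal_plan_def
  by (intro antisym INF_lower INF_greatest) auto

text \<open>The bound \<open>(norm (x - y))\<^sup>2 \<le> 2 * (norm x)\<^sup>2 + 2 * (norm
  y)\<^sup>2\<close> reduces the cost to the second moments of the marginals. Finiteness is what
  later allows computing with real numbers.\<close>

lemma transport_cost_finite:
  assumes "\<gamma> \<in> couplings \<mu> \<nu>" "finite_second_moment \<mu>" "finite_second_moment \<nu>"
  shows "transport_cost \<gamma> < \<infinity>"
proof -
  note \<gamma> = couplingsD[OF assms(1)]
  note [measurable_cong] = borel_probD(2)[OF \<gamma>(1)]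
  have "integrable (distr \<gamma> borel fst) (\<lambda>x. (norm x)\<^sup>2)" "integrable (distr \<gamma> borel snd) (\<lambda>x. (norm x)\<^sup>2)"
    using assms \<gamma> by (simp_all add: finite_second_moment_def)
  hence "integrable \<gamma> (\<lambda>z. (norm (fst z))\<^sup>2)" "integrable \<gamma> (\<lambda>z. (norm (snd z))\<^sup>2)"
    by (simp_all add: integrable_distr_eq)
  hence int: "integrable \<gamma> (\<lambda>z. 2 * (norm (fst z))\<^sup>2 + 2 * (norm (snd z))\<^sup>2)" by simp
  have "(norm (x - y))\<^sup>2 \<le> 2 * (norm x)\<^sup>2 + 2 * (norm y)\<^sup>2" for x y :: 'a
  proof -
    have "(norm (x - y))\<^sup>2 \<le> (norm x + norm y)\<^sup>2"
      by (intro power_mono norm_triangle_ineq4) auto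
    also have "\<dots> \<le> 2 * (norm x)\<^sup>2 + 2 * (norm y)\<^sup>2"
      using sum_squares_bound[of "norm x" "norm y"] by (simp add: power2_sum)
    finally show ?thesis .
  qed
  hence "transport_cost \<gamma> \<le> (\<integral>\<^sup>+ z. ennreal (2 * (norm (fst z))\<^sup>2 + 2 * (norm (snd z))\<^sup>2) \<partial>\<gamma>)"
    unfolding transport_cost_def by (intro nn_integral_mono ennreal_leI)
  also have "\<dots> < \<infinity>"
    using integrableD(2)[OF int] by (simp add: less_top)
  finally show ?thesis .
qed

section \<open>McCann interpolation and its obvious couplings\<close>

lemma interp_map_measurable [measurable]:
  "interp_map t \<in> borel_measurable (borel :: ('a::euclidean_space \<times> 'a) measure)"
  unfolding interp_map_def split_beta' by measurable

lemma mccann_1: "\<pi> \<in> couplings \<mu> \<nu> \<Longrightarrow> mccann \<pi> 1 = \<nu>"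
  by (auto simp: mccann_def interp_map_def split_beta' couplings_def)

text \<open>Under \<open>interp_map t\<close> each point travels the fraction \<open>t\<close> of
  its displacement; the competitor is the joint law of \<open>fst\<close> and
  \<open>interp_map t\<close> under \<open>\<pi>\<close>.\<close>

lemma W2_squared_mccann_left:
  assumes "\<pi> \<in> couplings \<mu> \<nu>"
  shows "W2_squared \<mu> (mccann \<pi> t) \<le> ennreal (t\<^sup>2) * transport_cost \<pi>"
proof -
  note \<pi> = couplingsD[OF assms(1)]
  note [measurable_cong] = borel_probD(2)[OF \<pi>(1)]
  have *: "norm (fst z - interp_map t z) = \<bar>t\<bar> * norm (fst z - snd z)" for z :: "'a \<times> 'a"
  proof -
    have "fst z - interp_map t z = t *\<^sub>R (fst z - snd z)"
      by (simp add: interp_map_def split_beta' algebra_simps)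
    thus ?thesis by simp
  qed
  have "W2_squared \<mu> (mccann \<pi> t) \<le> transport_cost (distr \<pi> borel (\<lambda>z. (fst z, interp_map t z)))"
    using distr_mem_couplings[of \<pi> fst "interp_map t"] \<pi> borel_probD[OF \<pi>(1)]
    by (intro W2_squared_le) (simp add: mccann_def)
  also have "\<dots> = (\<integral>\<^sup>+ z. ennreal (t\<^sup>2) * ennreal ((norm (fst z - snd z))\<^sup>2) \<partial>\<pi>)"
    using borel_probD(2)[OF \<pi>(1)]
    by (subst transport_cost_distr) (auto simp: * power_mult_distrib ennreal_mult)
  also have "\<dots> = ennreal (t\<^sup>2) * transport_cost \<pi>"
    unfolding transport_cost_def by (rule nn_integral_cmult) simp
  finally show ?thesis .
qed

text \<open>Seen from the other endpoint, the remaining fraction of the displacement is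
  \<open>1 - t\<close>.\<close>

lemma W2_squared_mccann_right:
  assumes "\<pi> \<in> couplings \<mu> \<nu>"
  shows "W2_squared \<nu> (mccann \<pi> t) \<le> ennreal ((1 - t)\<^sup>2) * transport_cost \<pi>"
proof -
  note \<pi> = couplingsD[OF assms(1)]
  note [measurable_cong] = borel_probD(2)[OF \<pi>(1)]
  have *: "norm (snd z - interp_map t z) = \<bar>1 - t\<bar> * norm (fst z - snd z)" for z :: "'a \<times> 'a"
  proof -
    have "snd z - interp_map t z = (1 - t) *\<^sub>R (snd z - fst z)"
      by (simp add: interp_map_def split_beta' algebra_simps)
    thus ?thesis by (simp add: norm_minus_commute)
  qed
  have "W2_squared \<nu> (mccann \<pi> t) \<le> transport_cost (distr \<pi> borel (\<lambda>z. (snd z, interp_map t z)))"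
    using distr_mem_couplings[of \<pi> snd "interp_map t"] \<pi> borel_probD[OF \<pi>(1)]
    by (intro W2_squared_le) (simp add: mccann_def)
  also have "\<dots> = (\<integral>\<^sup>+ z. ennreal ((1 - t)\<^sup>2) * ennreal ((norm (fst z - snd z))\<^sup>2) \<partial>\<pi>)"
    using borel_probD(2)[OF \<pi>(1)]
    by (subst transport_cost_distr) (auto simp: * power_mult_distrib ennreal_mult)
  also have "\<dots> = ennreal ((1 - t)\<^sup>2) * transport_cost \<pi>"
    unfolding transport_cost_def by (rule nn_integral_cmult) simp
  finally show ?thesis .
qed

section \<open>Gluing two plans up to a small error\<close>

text \<open>Enumerate a countable dense set and let \<open>k x\<close> be the first index whose
  point is closer than \<open>\<delta> / 2\<close> to \<open>x\<close>. Equal labels then mean a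
  common centre, and the triangle inequality applies.\<close>

lemma ex_small_countable_partition:
  assumes "\<delta> > 0"
  obtains k :: "'a::euclidean_space \<Rightarrow> nat"
  where "k \<in> measurable borel (count_space UNIV)" "\<And>x y. k x = k y \<Longrightarrow> dist x y \<le> \<delta>"
proof -
  obtain D :: "'a set" where D: "countable D" "\<And>X. open X \<Longrightarrow> X \<noteq> {} \<Longrightarrow> \<exists>d\<in>D. d \<in> X"
    using countable_dense_setE by blast
  have "D \<noteq> {}" using D(2)[of UNIV] by auto
  define q where "q = from_nat_into D"
  define k where "k x = (LEAST n. dist (q n) x < \<delta> / 2)" for x
  have k: "dist (q (k x)) x < \<delta> / 2" for x
  proof -
    obtain d where "d \<in> D" "d \<in> ball x (\<delta> / 2)"
      using D(2)[of "ball x (\<delta> / 2)"] assms by auto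
    then obtain n where "dist (q n) x < \<delta> / 2"
      using D(1) from_nat_into_surj[of D d] by (auto simp: q_def dist_commute)
    thus ?thesis unfolding k_def by (rule LeastI)
  qed
  show thesis
  proof
    show "k \<in> measurable borel (count_space UNIV)"
      unfolding k_def by (rule measurable_Least) measurable
    show "dist x y \<le> \<delta>" if "k x = k y" for x y
      using k[of x] k[of y] that dist_triangle3[of x y "q (k x)"] by auto
  qed
qed

text \<open>Integrating the weight \<open>1 / p\<close> over a cell of mass \<open>p\<close> gives
  1. This fails on cells of mass 0, where the integral is 0, but there are only countably many of
  them and together they form a null set.\<close>

lemma cell_density_integral:
  fixes k :: "'a \<Rightarrow> nat" and l :: "'b \<Rightarrow> nat"
  assumes "prob_space M" "prob_space N"
    and [measurable]: "k \<in> measurable M (count_space UNIV)" "l \<in> measurable N (count_space UNIV)"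
    and p: "\<And>n. emeasure M {x \<in> space M. k x = n} = p n" "\<And>n. emeasure N {y \<in> space N. l y = n} = p n"
  shows "AE x in M. (\<integral>\<^sup>+y. inverse (p (k x)) * indicator {y \<in> space N. l y = k x} y \<partial>N) = 1"
proof -
  interpret M: prob_space M by fact
  have top: "p n \<noteq> \<top>" for n
    unfolding p(1)[symmetric] by (rule M.emeasure_finite)
  have "AE x in M. p n = 0 \<longrightarrow> k x \<noteq> n" for n
  proof (cases "p n = 0")
    case True
    hence "{x \<in> space M. k x = n} \<in> null_sets M" using p(1)[of n] by (intro null_setsI) auto
    from AE_not_in[OF this] show ?thesis by (rule eventually_mono[OF eventually_conj[OF AE_space]]) auto
  qed simp
  hence "AE x in M. \<forall>n. p n = 0 \<longrightarrow> k x \<noteq> n" by (simp add: AE_all_countable)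
  thus ?thesis
  proof eventually_elim
    fix x assume "\<forall>n. p n = 0 \<longrightarrow> k x \<noteq> n"
    hence "p (k x) \<noteq> 0" by blast
    have "(\<integral>\<^sup>+y. inverse (p (k x)) * indicator {y \<in> space N. l y = k x} y \<partial>N) = inverse (p (k x)) * p (k x)"
      by (subst nn_integral_cmult_indicator) (simp_all add: p(2))
    also have "\<dots> = 1"
      using \<open>p (k x) \<noteq> 0\<close> top[of "k x"] ennreal_divide_self[of "p (k x)"]
      by (simp add: divide_ennreal_def mult.commute less_top)
    finally show "(\<integral>\<^sup>+y. inverse (p (k x)) * indicator {y \<in> space N. l y = k x} y \<partial>N) = 1" .
  qed
qed

text \<open>Replaces the gluing lemma: the two measures are made conditionally independent given the cell
  of a countable partition, which avoids disintegration.\<close>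

lemma ex_coupling_matching_cells:
  fixes k :: "'a \<Rightarrow> nat" and l :: "'b \<Rightarrow> nat"
  assumes "prob_space M" "prob_space N"
    and [measurable]: "k \<in> measurable M (count_space UNIV)" "l \<in> measurable N (count_space UNIV)"
    and cells: "\<And>n. emeasure M {x \<in> space M. k x = n} = emeasure N {y \<in> space N. l y = n}"
  obtains \<Gamma> where "prob_space \<Gamma>" "sets \<Gamma> = sets (M \<Otimes>\<^sub>M N)"
    "distr \<Gamma> M fst = M" "distr \<Gamma> N snd = N" "AE w in \<Gamma>. k (fst w) = l (snd w)"
proof -
  interpret M: prob_space M by fact
  interpret N: prob_space N by fact
  interpret P: pair_sigma_finite M N ..
  define p where "p n = emeasure N {y \<in> space N. l y = n}" for n
  \<comment> \<open>The product measure gives the matching pair of cells \<open>n\<close> the mass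
    \<open>p n * p n\<close>; the weight \<open>1 / p n\<close> corrects this to
    \<open>p n\<close>.\<close>
  define h where "h w = (if k (fst w) = l (snd w) then inverse (p (k (fst w))) else 0)" for w
  have "(\<lambda>w. inverse (p (k (fst w)))) \<in> borel_measurable (M \<Otimes>\<^sub>M N)"
    by (rule measurable_compose[of "\<lambda>w. k (fst w)" _ "count_space UNIV"]) simp_all
  \<comment> \<open>The countable quantifier over the common label reduces measurability of the
    matching event to that of single cells.\<close>
  moreover have "{w \<in> space (M \<Otimes>\<^sub>M N). \<exists>n. l (snd w) = n \<and> k (fst w) = n} \<in> sets (M \<Otimes>\<^sub>M N)"
    by measurable
  ultimately have [measurable]: "h \<in> borel_measurable (M \<Otimes>\<^sub>M N)"
    unfolding h_def by (intro measurable_If) auto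
  define \<Gamma> where "\<Gamma> = density (M \<Otimes>\<^sub>M N) h"
  have sets_\<Gamma> [simp, measurable_cong]: "sets \<Gamma> = sets (M \<Otimes>\<^sub>M N)" by (simp add: \<Gamma>_def)
  have p: "emeasure M {x \<in> space M. k x = n} = p n" "emeasure N {y \<in> space N. l y = n} = p n" for n
    by (simp_all add: p_def cells)
  have "(\<integral>\<^sup>+y. h (x, y) \<partial>N) = (\<integral>\<^sup>+y. inverse (p (k x)) * indicator {y \<in> space N. l y = k x} y \<partial>N)" for x
    by (intro nn_integral_cong) (auto simp: h_def)
  hence hN: "AE x in M. (\<integral>\<^sup>+y. h (x, y) \<partial>N) = 1"
    using cell_density_integral[OF assms(1-4) p] by (simp only:)
  have "(\<integral>\<^sup>+x. h (x, y) \<partial>M) = (\<integral>\<^sup>+x. inverse (p (l y)) * indicator {x \<in> space M. k x = l y} x \<partial>M)" for y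
    by (intro nn_integral_cong) (auto simp: h_def)
  hence hM: "AE y in N. (\<integral>\<^sup>+x. h (x, y) \<partial>M) = 1"
    using cell_density_integral[OF assms(2,1,4,3) p(2,1)] by (simp only:)
  have distr_fst: "distr \<Gamma> M fst = M"
  proof (rule measure_eqI)
    fix A assume "A \<in> sets (distr \<Gamma> M fst)"
    hence [measurable]: "A \<in> sets M" by simp
    have "emeasure (distr \<Gamma> M fst) A = (\<integral>\<^sup>+w. indicator A (fst w) \<partial>\<Gamma>)"
      by (subst nn_integral_indicator[symmetric], simp, subst nn_integral_distr) auto
    also have "\<dots> = (\<integral>\<^sup>+w. h w * indicator A (fst w) \<partial>(M \<Otimes>\<^sub>M N))"
      unfolding \<Gamma>_def by (subst nn_integral_density) auto
    also have "\<dots> = (\<integral>\<^sup>+x. (\<integral>\<^sup>+y. h (x, y) \<partial>N) * indicator A x \<partial>M)"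
      by (subst N.nn_integral_fst[symmetric]) (auto simp: nn_integral_multc intro!: nn_integral_cong)
    also have "\<dots> = (\<integral>\<^sup>+x. indicator A x \<partial>M)"
      by (rule nn_integral_cong_AE) (use hN in eventually_elim, simp)
    finally show "emeasure (distr \<Gamma> M fst) A = emeasure M A" by simp
  qed simp
  have distr_snd: "distr \<Gamma> N snd = N"
  proof (rule measure_eqI)
    fix A assume "A \<in> sets (distr \<Gamma> N snd)"
    hence [measurable]: "A \<in> sets N" by simp
    have "emeasure (distr \<Gamma> N snd) A = (\<integral>\<^sup>+w. indicator A (snd w) \<partial>\<Gamma>)"
      by (subst nn_integral_indicator[symmetric], simp, subst nn_integral_distr) auto
    also have "\<dots> = (\<integral>\<^sup>+w. h w * indicator A (snd w) \<partial>(M \<Otimes>\<^sub>M N))"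
      unfolding \<Gamma>_def by (subst nn_integral_density) auto
    also have "\<dots> = (\<integral>\<^sup>+y. (\<integral>\<^sup>+x. h (x, y) \<partial>M) * indicator A y \<partial>N)"
      by (subst P.nn_integral_snd[symmetric]) (auto simp: nn_integral_multc intro!: nn_integral_cong)
    also have "\<dots> = (\<integral>\<^sup>+y. indicator A y \<partial>N)"
      by (rule nn_integral_cong_AE) (use hM in eventually_elim, simp)
    finally show "emeasure (distr \<Gamma> N snd) A = emeasure N A" by simp
  qed simp
  show thesis
  proof
    \<comment> \<open>A pushforward keeps the total mass, so \<open>\<Gamma>\<close> inherits mass 1
      from its first marginal.\<close>
    have "prob_space (distr \<Gamma> M fst)" by (simp add: distr_fst M.prob_space_axioms)
    thus "prob_space \<Gamma>" by (rule prob_space_distrD[rotated]) measurable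
    show "AE w in \<Gamma>. k (fst w) = l (snd w)"
      unfolding \<Gamma>_def by (subst AE_density) (auto simp: h_def)
  qed (simp_all add: distr_fst distr_snd)
qed

text \<open>Both plans have second marginal \<open>\<sigma>\<close>, so the label of
  \<open>snd\<close> has the same cell masses under each and the cells can be matched. Exact gluing
  would identify the two \<open>\<sigma>\<close>-coordinates; here they share a cell of diameter at
  most \<open>\<delta>\<close>, and \<open>\<delta>\<close> is sent to 0 afterwards.\<close>

lemma approximate_gluing:
  fixes \<gamma> \<gamma>' :: "('a::euclidean_space \<times> 'a) measure"
  assumes "\<gamma> \<in> couplings \<mu> \<sigma>" "\<gamma>' \<in> couplings \<nu> \<sigma>" "\<delta> > 0"
  obtains \<Gamma> :: "(('a \<times> 'a) \<times> ('a \<times> 'a)) measure"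
  where "borel_prob \<Gamma>" "distr \<Gamma> borel fst = \<gamma>" "distr \<Gamma> borel snd = \<gamma>'"
    "AE w in \<Gamma>. norm (snd (fst w) - snd (snd w)) \<le> \<delta>"
proof -
  note \<gamma> = couplingsD[OF assms(1)] and \<gamma>' = couplingsD[OF assms(2)]
  note sets = borel_probD(2)[OF \<gamma>(1)] borel_probD(2)[OF \<gamma>'(1)]
  note [measurable_cong] = sets
  obtain k :: "'a \<Rightarrow> nat" where k [measurable]: "k \<in> measurable borel (count_space UNIV)"
    and small: "\<And>x y. k x = k y \<Longrightarrow> dist x y \<le> \<delta>"
    by (rule ex_small_countable_partition[OF \<open>\<delta> > 0\<close>]) blast
  have cell: "emeasure \<sigma> {y. k y = n} = emeasure \<rho> {z \<in> space \<rho>. k (snd z) = n}"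
    if "borel_prob \<rho>" "distr \<rho> borel snd = \<sigma>" for n and \<rho> :: "('a \<times> 'a) measure"
  proof -
    note [measurable_cong] = borel_probD(2)[OF that(1)]
    have "{y. k y = n} \<in> sets borel" by measurable
    thus ?thesis
      unfolding that(2)[symmetric]
      by (subst emeasure_distr) (auto simp: vimage_def Int_def conj_commute)
  qed
  have "emeasure \<gamma> {z \<in> space \<gamma>. k (snd z) = n} = emeasure \<gamma>' {z \<in> space \<gamma>'. k (snd z) = n}" for n
    using cell[OF \<gamma>(1,3)] cell[OF \<gamma>'(1,3)] by simp
  moreover have "(\<lambda>z. k (snd z)) \<in> measurable \<gamma> (count_space UNIV)"
    "(\<lambda>z. k (snd z)) \<in> measurable \<gamma>' (count_space UNIV)" by measurable
  ultimately obtain \<Gamma> where \<Gamma>: "prob_space \<Gamma>" "sets \<Gamma> = sets (\<gamma> \<Otimes>\<^sub>M \<gamma>')"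
    "distr \<Gamma> \<gamma> fst = \<gamma>" "distr \<Gamma> \<gamma>' snd = \<gamma>'" "AE w in \<Gamma>. k (snd (fst w)) = k (snd (snd w))"
    using ex_coupling_matching_cells[OF borel_probD(1)[OF \<gamma>(1)] borel_probD(1)[OF \<gamma>'(1)]] by blast
  have "sets (\<gamma> \<Otimes>\<^sub>M \<gamma>') = sets borel"
    using sets_pair_measure_cong[OF sets] by (simp only: borel_prod)
  show thesis
  proof
    show "borel_prob \<Gamma>" using \<Gamma>(1,2) \<open>sets (\<gamma> \<Otimes>\<^sub>M \<gamma>') = sets borel\<close> by (simp add: borel_prob_def)
    show "distr \<Gamma> borel fst = \<gamma>" "distr \<Gamma> borel snd = \<gamma>'"
      using \<Gamma>(3,4) distr_cong[OF refl sets(1), of \<Gamma> fst fst] distr_cong[OF refl sets(2), of \<Gamma> snd snd]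
      by simp_all
    show "AE w in \<Gamma>. norm (snd (fst w) - snd (snd w)) \<le> \<delta>"
      using \<Gamma>(5) by eventually_elim (simp add: small flip: dist_norm)
  qed
qed

section \<open>Convexity inequality for the squared distance\<close>

text \<open>Rests on a quadratic identity in which the square of
  \<open>(1 - s) *\<^sub>R a + s *\<^sub>R b\<close> is dropped. The cross term caused by
  \<open>e\<close> grows with the norm of \<open>a - b\<close>, hence an error that is partly
  multiplicative.\<close>

lemma weighted_norm_sq_add_le:
  fixes a b e :: "'a::euclidean_space"
  assumes s: "0 \<le> s" "s \<le> 1" and \<delta>: "\<delta> > 0" and e: "norm e \<le> \<delta>"
  shows "s * (1 - s) * (norm (a - b + e))\<^sup>2
    \<le> (1 + \<delta>) * ((1 - s) * (norm a)\<^sup>2 + s * (norm b)\<^sup>2) + (\<delta> + \<delta>\<^sup>2)"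
proof -
  define c where "c = a - b"
  have "s * (1 - s) * (norm c)\<^sup>2 + (norm ((1 - s) *\<^sub>R a + s *\<^sub>R b))\<^sup>2
    = (1 - s) * (norm a)\<^sup>2 + s * (norm b)\<^sup>2"
    unfolding c_def power2_norm_eq_inner
    by (simp add: inner_diff inner_add inner_commute algebra_simps power2_eq_square)
  hence 1: "s * (1 - s) * (norm c)\<^sup>2 \<le> (1 - s) * (norm a)\<^sup>2 + s * (norm b)\<^sup>2"
    using zero_le_power2[of "norm ((1 - s) *\<^sub>R a + s *\<^sub>R b)"] by linarith
  have "(norm (c + e))\<^sup>2 \<le> (norm c + \<delta>)\<^sup>2"
    using norm_triangle_ineq[of c e] e by (intro power_mono) auto
  \<comment> \<open>The cross term is absorbed by
    \<open>2 * norm c \<le> (norm c)\<^sup>2 + 1\<close>, multiplied by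
    \<open>\<delta>\<close>.\<close>
  also have "\<dots> \<le> (1 + \<delta>) * (norm c)\<^sup>2 + (\<delta> + \<delta>\<^sup>2)"
    using mult_left_mono[OF sum_squares_bound[of "norm c" 1], of \<delta>] \<delta>
    by (simp add: power2_sum algebra_simps)
  finally have "s * (1 - s) * (norm (c + e))\<^sup>2 \<le> s * (1 - s) * ((1 + \<delta>) * (norm c)\<^sup>2 + (\<delta> + \<delta>\<^sup>2))"
    using s by (intro mult_left_mono) auto
  also have "\<dots> = (1 + \<delta>) * (s * (1 - s) * (norm c)\<^sup>2) + (s * (1 - s)) * (\<delta> + \<delta>\<^sup>2)"
    by (simp add: algebra_simps)
  also have "\<dots> \<le> (1 + \<delta>) * ((1 - s) * (norm a)\<^sup>2 + s * (norm b)\<^sup>2) + 1 * (\<delta> + \<delta>\<^sup>2)"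
    using s \<delta> 1 by (intro add_mono mult_left_mono mult_right_mono mult_le_one) auto
  finally show ?thesis by (simp add: c_def)
qed

text \<open>In an approximate gluing the two first coordinates form a coupling of
  \<open>\<mu>\<close> and \<open>\<nu>\<close>. Their difference is \<open>a - b + e\<close>, where
  \<open>a\<close> and \<open>b\<close> are the displacements in the two plans and \<open>e\<close>
  is the gap between the \<open>\<sigma>\<close>-coordinates.\<close>

lemma W2_squared_le_couplings:
  fixes \<mu> \<nu> \<sigma> :: "'a::euclidean_space measure"
  assumes "\<gamma> \<in> couplings \<mu> \<sigma>" "\<gamma>' \<in> couplings \<nu> \<sigma>" and s: "0 \<le> s" "s \<le> 1"
  shows "ennreal (s * (1 - s)) * W2_squared \<mu> \<nu>
    \<le> ennreal (1 - s) * transport_cost \<gamma> + ennreal s * transport_cost \<gamma>'" (is "?L \<le> ?C")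
proof -
  have approx: "?L \<le> ennreal (1 + \<delta>) * ?C + ennreal (\<delta> + \<delta>\<^sup>2)" if \<delta>: "\<delta> > 0" for \<delta> :: real
  proof -
    obtain \<Gamma> :: "(('a \<times> 'a) \<times> ('a \<times> 'a)) measure" where \<Gamma>: "borel_prob \<Gamma>"
      and \<Gamma>_fst: "distr \<Gamma> borel fst = \<gamma>" and \<Gamma>_snd: "distr \<Gamma> borel snd = \<gamma>'"
      and AE: "AE w in \<Gamma>. norm (snd (fst w) - snd (snd w)) \<le> \<delta>"
      by (rule approximate_gluing[OF assms(1,2) \<delta>]) blast
    interpret \<Gamma>: prob_space \<Gamma> by (rule borel_probD[OF \<Gamma>])
    note [measurable_cong] = borel_probD(2)[OF \<Gamma>]
    let ?a = "\<lambda>w::('a \<times> 'a) \<times> ('a \<times> 'a). fst (fst w) - snd (fst w)"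
    let ?b = "\<lambda>w::('a \<times> 'a) \<times> ('a \<times> 'a). fst (snd w) - snd (snd w)"
    let ?\<gamma> = "distr \<Gamma> borel (\<lambda>w. (fst (fst w), fst (snd w)))"
    have \<mu>: "distr \<Gamma> borel (\<lambda>w. fst (fst w)) = \<mu>"
      using distr_distr[of fst borel borel fst \<Gamma>] \<Gamma>_fst couplingsD(2)[OF assms(1)] by (simp add: comp_def)
    have \<nu>: "distr \<Gamma> borel (\<lambda>w. fst (snd w)) = \<nu>"
      using distr_distr[of fst borel borel snd \<Gamma>] \<Gamma>_snd couplingsD(2)[OF assms(2)] by (simp add: comp_def)
    have "?\<gamma> \<in> couplings \<mu> \<nu>"
      using distr_mem_couplings[of \<Gamma> "\<lambda>w. fst (fst w)" "\<lambda>w. fst (snd w)"] borel_probD[OF \<Gamma>]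
      by (simp add: \<mu> \<nu>)
    hence "?L \<le> ennreal (s * (1 - s)) * transport_cost ?\<gamma>"
      by (intro mult_left_mono W2_squared_le) auto
    also have "\<dots> = (\<integral>\<^sup>+w. ennreal (s * (1 - s)) * ennreal ((norm (fst (fst w) - fst (snd w)))\<^sup>2) \<partial>\<Gamma>)"
      using borel_probD(2)[OF \<Gamma>]
      by (subst transport_cost_distr) (auto simp: nn_integral_cmult)
    also have "\<dots> \<le> (\<integral>\<^sup>+w. ennreal (1 + \<delta>) * (ennreal (1 - s) * ennreal ((norm (?a w))\<^sup>2)
        + ennreal s * ennreal ((norm (?b w))\<^sup>2)) + ennreal (\<delta> + \<delta>\<^sup>2) \<partial>\<Gamma>)"
    proof (rule nn_integral_mono_AE, use AE in eventually_elim)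
      fix w :: "('a \<times> 'a) \<times> ('a \<times> 'a)"
      assume "norm (snd (fst w) - snd (snd w)) \<le> \<delta>"
      from weighted_norm_sq_add_le[OF s \<delta> this, of "?a w" "?b w"]
      show "ennreal (s * (1 - s)) * ennreal ((norm (fst (fst w) - fst (snd w)))\<^sup>2)
        \<le> ennreal (1 + \<delta>) * (ennreal (1 - s) * ennreal ((norm (?a w))\<^sup>2)
        + ennreal s * ennreal ((norm (?b w))\<^sup>2)) + ennreal (\<delta> + \<delta>\<^sup>2)"
        using s \<delta> by (simp flip: ennreal_mult ennreal_plus)
    qed
    also have "\<dots> = ennreal (1 + \<delta>) * (ennreal (1 - s) * (\<integral>\<^sup>+w. ennreal ((norm (?a w))\<^sup>2) \<partial>\<Gamma>)
        + ennreal s * (\<integral>\<^sup>+w. ennreal ((norm (?b w))\<^sup>2) \<partial>\<Gamma>)) + ennreal (\<delta> + \<delta>\<^sup>2)"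
      using \<Gamma>.emeasure_space_1 by (simp add: nn_integral_add nn_integral_cmult)
    also have "(\<integral>\<^sup>+w. ennreal ((norm (?a w))\<^sup>2) \<partial>\<Gamma>) = transport_cost \<gamma>"
      unfolding transport_cost_def \<Gamma>_fst[symmetric] by (subst nn_integral_distr) auto
    also have "(\<integral>\<^sup>+w. ennreal ((norm (?b w))\<^sup>2) \<partial>\<Gamma>) = transport_cost \<gamma>'"
      unfolding transport_cost_def \<Gamma>_snd[symmetric] by (subst nn_integral_distr) auto
    finally show ?thesis .
  qed
  show ?thesis
  \<comment> \<open>For a finite right-hand side the error bound converges to it as
    \<open>\<delta>\<close> decreases to 0; an infinite one is trivial.\<close>
  proof (cases "?C = \<top>")
    case False
    have "((\<lambda>\<delta>. ennreal (1 + \<delta>) * ?C + ennreal (\<delta> + \<delta>\<^sup>2))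
      \<longlongrightarrow> ennreal (1 + 0) * ?C + ennreal (0 + 0\<^sup>2)) (at_right 0)"
      using False by (intro tendsto_intros ennreal_tendsto_cmult) auto
    hence "((\<lambda>\<delta>. ennreal (1 + \<delta>) * ?C + ennreal (\<delta> + \<delta>\<^sup>2)) \<longlongrightarrow> ?C) (at_right 0)" by simp
    moreover have "\<forall>\<^sub>F \<delta> in at_right 0. ?L \<le> ennreal (1 + \<delta>) * ?C + ennreal (\<delta> + \<delta>\<^sup>2)"
      using approx by (auto simp: eventually_at_right_field intro: exI[of _ 1])
    ultimately show ?thesis
      by (rule tendsto_lowerbound) simp
  next
    case True
    thus ?thesis by (simp only: top_greatest)
  qed
qed

text \<open>Passes from couplings to infima through couplings whose cost is within \<open>e\<close>
  of the infimum, so existence of optimal plans to \<open>\<sigma>\<close> is not at issue.\<close>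

lemma W2_squared_convexity:
  fixes \<mu> \<nu> \<sigma> :: "'a::euclidean_space measure"
  assumes s: "0 \<le> s" "s \<le> 1"
  shows "ennreal (s * (1 - s)) * W2_squared \<mu> \<nu>
    \<le> ennreal (1 - s) * W2_squared \<mu> \<sigma> + ennreal s * W2_squared \<nu> \<sigma>"
\<comment> \<open>At the endpoints the left factor vanishes. In between both weights are positive,
  so a finite weighted sum forces both distances to be finite.\<close>
proof (cases "s = 0 \<or> s = 1")
  case False
  hence s': "0 < s" "s < 1" using s by auto
  show ?thesis
  proof (rule ennreal_le_epsilon)
    fix e :: real assume "e > 0"
    assume "ennreal (1 - s) * W2_squared \<mu> \<sigma> + ennreal s * W2_squared \<nu> \<sigma> < \<top>"
    hence fin: "W2_squared \<mu> \<sigma> \<noteq> \<infinity>" "W2_squared \<nu> \<sigma> \<noteq> \<infinity>"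
      using s' by (auto simp: ennreal_mult_top)
    obtain \<gamma> where \<gamma>: "\<gamma> \<in> couplings \<mu> \<sigma>" "transport_cost \<gamma> \<le> W2_squared \<mu> \<sigma> + e"
      using INF_approx_ennreal[OF \<open>e > 0\<close> W2_squared_def fin(1)] by (auto intro: less_imp_le)
    obtain \<gamma>' where \<gamma>': "\<gamma>' \<in> couplings \<nu> \<sigma>" "transport_cost \<gamma>' \<le> W2_squared \<nu> \<sigma> + e"
      using INF_approx_ennreal[OF \<open>e > 0\<close> W2_squared_def fin(2)] by (auto intro: less_imp_le)
    have "ennreal (s * (1 - s)) * W2_squared \<mu> \<nu>
      \<le> ennreal (1 - s) * transport_cost \<gamma> + ennreal s * transport_cost \<gamma>'"
      by (rule W2_squared_le_couplings[OF \<gamma>(1) \<gamma>'(1) s])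
    also have "\<dots> \<le> ennreal (1 - s) * (W2_squared \<mu> \<sigma> + e) + ennreal s * (W2_squared \<nu> \<sigma> + e)"
      by (intro add_mono mult_left_mono \<gamma>(2) \<gamma>'(2)) auto
    also have "\<dots> = ennreal (1 - s) * W2_squared \<mu> \<sigma> + ennreal s * W2_squared \<nu> \<sigma>
        + (ennreal (1 - s) * e + ennreal s * e)"
      by (simp add: distrib_left ac_simps)
    also have "ennreal (1 - s) * e + ennreal s * e = ennreal e"
      using s \<open>e > 0\<close> by (simp add: algebra_simps flip: ennreal_mult ennreal_plus)
    finally show "ennreal (s * (1 - s)) * W2_squared \<mu> \<nu>
      \<le> ennreal (1 - s) * W2_squared \<mu> \<sigma> + ennreal s * W2_squared \<nu> \<sigma> + ennreal e" .
  qed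
qed auto

section \<open>Geodesic property and the final comparison\<close>

text \<open>The coupling bounds \<open>t\<^sup>2 * D\<close> and \<open>(1 - t)\<^sup>2 * D\<close>
  already saturate the convexity inequality with weight \<open>t\<close> at the intermediate
  measure, so the first of them cannot be strict.\<close>

lemma W2_squared_mccann_optimal:
  assumes \<pi>: "optimal_plan \<pi> \<mu> \<nu>" and D: "W2_squared \<mu> \<nu> = ennreal D" "0 \<le> D"
    and t: "0 \<le> t" "t \<le> 1"
  shows "W2_squared \<mu> (mccann \<pi> t) = ennreal (t\<^sup>2 * D)"
proof -
  have \<pi>_mem: "\<pi> \<in> couplings \<mu> \<nu>" using \<pi> by (simp add: optimal_plan_def)
  define w where "w = enn2real (W2_squared \<mu> (mccann \<pi> t))"
  define v where "v = enn2real (W2_squared \<nu> (mccann \<pi> t))"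
  have upper: "W2_squared \<mu> (mccann \<pi> t) \<le> ennreal (t\<^sup>2 * D)"
    "W2_squared \<nu> (mccann \<pi> t) \<le> ennreal ((1 - t)\<^sup>2 * D)"
    using W2_squared_mccann_left[OF \<pi>_mem, of t] W2_squared_mccann_right[OF \<pi>_mem, of t] D
    by (simp_all add: W2_squared_optimal_plan[OF \<pi>] ennreal_mult)
  \<comment> \<open>The upper bounds make both distances finite, so \<open>enn2real\<close> loses
    nothing.\<close>
  hence w: "W2_squared \<mu> (mccann \<pi> t) = ennreal w" "w \<ge> 0"
    and v: "W2_squared \<nu> (mccann \<pi> t) = ennreal v" "v \<ge> 0"
    by (auto simp: w_def v_def ennreal_enn2real_if top_unique)
  have "t\<^sup>2 * D \<le> w"
  \<comment> \<open>The factor \<open>1 - t\<close> to be cancelled vanishes at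
    \<open>t = 1\<close>, where the interpolation has reached \<open>\<nu>\<close>.\<close>
  proof (cases "t = 1")
    case True
    thus ?thesis using mccann_1[OF \<pi>_mem] w D by simp
  next
    case False
    have "t * (1 - t) * D \<le> (1 - t) * w + t * v"
      using W2_squared_convexity[OF t, of \<mu> \<nu> "mccann \<pi> t"] t D w v
      by (simp add: ennreal_le_iff flip: ennreal_mult ennreal_plus)
    also have "t * v \<le> t * ((1 - t)\<^sup>2 * D)"
      using upper(2) t D(2) v by (intro mult_left_mono) (simp_all add: ennreal_le_iff)
    finally have "(1 - t) * (t\<^sup>2 * D) \<le> (1 - t) * w"
      by (simp add: algebra_simps power2_eq_square)
    thus ?thesis using False t by simp
  qed
  thus ?thesis using upper(1) w by (auto intro: antisym ennreal_leI)
qed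

theorem theorem1:
  fixes \<mu> \<nu> \<nu>' \<mu>\<^sub>t :: "(real ^ 'd) measure"
    and \<pi> \<pi>' :: "((real ^ 'd) \<times> (real ^ 'd)) measure"
    and s t :: real
  assumes "borel_prob \<mu>" and "finite_second_moment \<mu>"
    and "borel_prob \<nu>" and "finite_second_moment \<nu>"
    and "borel_prob \<nu>'" and "finite_second_moment \<nu>'"
    and "optimal_plan \<pi> \<mu> \<nu>"
    and "optimal_plan \<pi>' \<mu> \<nu>'"
    and "contains_mccann \<mu> \<nu>' \<pi>' \<mu> \<nu> \<pi>"
    and "t \<in> {0..1}"
    and "\<mu>\<^sub>t = mccann \<pi> t"
    and "s \<in> {0..1}"
    and "mccann \<pi>' s = mccann \<pi> t"
  shows "ennreal (1 - t) * W2_squared \<mu> \<mu>\<^sub>t + ennreal t * W2_squared \<nu> \<mu>\<^sub>t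
       \<le> ennreal (1 - s) * W2_squared \<mu> \<mu>\<^sub>t + ennreal s * W2_squared \<nu>' \<mu>\<^sub>t"
proof -
  have t: "0 \<le> t" "t \<le> 1" and s: "0 \<le> s" "s \<le> 1" using assms by auto
  have \<sigma>: "\<mu>\<^sub>t = mccann \<pi> t" "\<mu>\<^sub>t = mccann \<pi>' s" using assms by simp_all
  have \<pi>: "\<pi> \<in> couplings \<mu> \<nu>" and \<pi>': "\<pi>' \<in> couplings \<mu> \<nu>'"
    using assms by (auto simp: optimal_plan_def)
  define D where "D = enn2real (W2_squared \<mu> \<nu>)"
  define D' where "D' = enn2real (W2_squared \<mu> \<nu>')"
  have D: "W2_squared \<mu> \<nu> = ennreal D" "D \<ge> 0"
    using transport_cost_finite[OF \<pi>] W2_squared_optimal_plan[OF assms(7)] assms by (auto simp: D_def)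
  have D': "W2_squared \<mu> \<nu>' = ennreal D'" "D' \<ge> 0"
    using transport_cost_finite[OF \<pi>'] W2_squared_optimal_plan[OF assms(8)] assms by (auto simp: D'_def)
  have w: "W2_squared \<mu> \<mu>\<^sub>t = ennreal (t\<^sup>2 * D)" "W2_squared \<mu> \<mu>\<^sub>t = ennreal (s\<^sup>2 * D')"
    using W2_squared_mccann_optimal[OF assms(7) D t] W2_squared_mccann_optimal[OF assms(8) D' s] \<sigma>
    by simp_all
  hence eq: "t\<^sup>2 * D = s\<^sup>2 * D'" using D(2) D'(2) by simp
  \<comment> \<open>Containment at time 1 places \<open>\<nu>\<close> at some time \<open>r\<close>
    on the way to \<open>\<nu>'\<close>, and the geodesic formula at \<open>r\<close> evaluates
    \<open>D\<close>.\<close>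
  have "D \<le> D'"
  proof -
    obtain a b r where "{a..b} \<subseteq> {0..1}" "r \<in> {a..b}" and r: "mccann \<pi>' r = mccann \<pi> 1"
      using assms(9) unfolding contains_mccann_def by fastforce
    hence r01: "0 \<le> r" "r \<le> 1" by auto
    have "D = r\<^sup>2 * D'"
      using W2_squared_mccann_optimal[OF assms(8) D' r01] D D' by (simp add: r mccann_1[OF \<pi>])
    also have "\<dots> \<le> 1 * D'" using r01 D'(2) by (intro mult_right_mono power_le_one) auto
    finally show ?thesis by simp
  qed
  \<comment> \<open>Squaring brings in the known equality of \<open>t\<^sup>2 * D\<close> and
    \<open>s\<^sup>2 * D'\<close>; what remains is to compare the leftover factors \<open>D\<close>
    and \<open>D'\<close>.\<close>
  have "(t * D)\<^sup>2 = (t\<^sup>2 * D) * D" by (simp add: power2_eq_square)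
  also have "\<dots> \<le> (s\<^sup>2 * D') * D'"
    unfolding eq using \<open>D \<le> D'\<close> D'(2) by (intro mult_left_mono) auto
  also have "\<dots> = (s * D')\<^sup>2" by (simp add: power2_eq_square)
  finally have "t * D \<le> s * D'" by (rule power2_le_imp_le) (use s D'(2) in simp)
  \<comment> \<open>Subtract the common value from \<open>eq\<close> on both sides.\<close>
  hence "t * (1 - t) * D \<le> s * (1 - s) * D'"
    using eq by (simp add: algebra_simps power2_eq_square)
  \<comment> \<open>The first distance is known exactly; for the second an upper bound suffices on
    this side.\<close>
  have "ennreal (1 - t) * W2_squared \<mu> \<mu>\<^sub>t + ennreal t * W2_squared \<nu> \<mu>\<^sub>t
    \<le> ennreal (1 - t) * ennreal (t\<^sup>2 * D) + ennreal t * ennreal ((1 - t)\<^sup>2 * D)"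
    using W2_squared_mccann_right[OF \<pi>, of t] D
    by (intro add_mono mult_left_mono)
      (simp_all add: w(1) \<sigma>(1)[symmetric] W2_squared_optimal_plan[OF assms(7)] ennreal_mult)
  also have "\<dots> = ennreal ((1 - t) * (t\<^sup>2 * D) + t * ((1 - t)\<^sup>2 * D))"
    using t D(2) by (simp flip: ennreal_mult ennreal_plus)
  also have "(1 - t) * (t\<^sup>2 * D) + t * ((1 - t)\<^sup>2 * D) = t * (1 - t) * D"
    by (simp add: algebra_simps power2_eq_square)
  also have "ennreal \<dots> \<le> ennreal (s * (1 - s) * D')" by (rule ennreal_leI) fact
  also have "\<dots> = ennreal (s * (1 - s)) * W2_squared \<mu> \<nu>'"
    using s D' by (simp add: ennreal_mult)
  \<comment> \<open>Convexity for the pair \<open>\<mu>\<close>, \<open>\<nu>'\<close> with weight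
    \<open>s\<close> and \<open>\<mu>\<^sub>t\<close> as the intermediate measure.\<close>
  also have "\<dots> \<le> ennreal (1 - s) * W2_squared \<mu> \<mu>\<^sub>t + ennreal s * W2_squared \<nu>' \<mu>\<^sub>t"
    by (rule W2_squared_convexity[OF s])
  finally show ?thesis .
qed

end
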